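(* Fix a tree partition of $\omega$. For all $k\ge2$, $\mathcal G_k\subseteq\mathcal H_2$ and $\mathcal G_k\not\subseteq\mathcal H_1$.
   Context: A tree partition of $\omega$ is a family $\langle A_s:s\in\omega^{<\omega}\rangle$ of infinite subsets of $\omega$ such that $A_\varnothing=\omega$, for each $s$ the family $\{A_{s^\frown n}:n\in\omega\}$ is a partition of $A_s$, and any two distinct points of $\omega$ lie in different cells $A_s\neq A_t$ with $|s|=|t|=n$ for some $n$. For $x\in\omega$, $b_x\in\omega^\omega$ is the unique branch with $x\in A_{b_x\upharpoonright n}$ for all $n$; for $x\ne y$, $\Delta(x,y)=\min\{n:b_x(n)\ne b_y(n)\}$. For $X\subseteq\omega$ let $T^\infty_X=\{s\in\omega^{<\omega}:X\cap A_s\text{ is infinite}\}$. For $k\ge2$, $c_k(\{x,y\})=\Delta(x,y)\bmod k$; a set $H\subseteq\omega$ is $c_k$-homogeneous if $c_k$ is constant on the pairs of elements of $H$; $\mathcal G_k$ is the ideal generated by the $c_k$-homogeneous sets (and the finite sets). For $T\subseteq\omega^{<\omega}$ put $\mathrm{Succ}_T(s)=\{n:s^\frown n\in T\}$ and $D(T)=\{s\in T:\mathrm{Succ}_T(s)\text{ is infinite}\}$; $D^1=D$, $D^2=D\circ D$. $\mathcal H_n=\{X\subseteq\omega:\varnothing\notin D^n(T^\infty_X)\}$. *)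

theory Defs
  imports Main "HOL-Library.Disjoint_Sets"
begin

text \<open>
  Finite sequences of naturals are lists; \<open>s @ [n]\<close> is the extension of \<open>s\<close> by \<open>n\<close>, and
  \<open>map b [0..<n]\<close> is the restriction of \<open>b\<close> to its first \<open>n\<close> values.
\<close>

definition tree_partition :: "(nat list \<Rightarrow> nat set) \<Rightarrow> bool" where
  "tree_partition A \<longleftrightarrow>
     (\<forall>s. infinite (A s)) \<and>
     A [] = UNIV \<and>
     (\<forall>s. disjoint_family (\<lambda>n. A (s @ [n])) \<and> (\<Union>n. A (s @ [n])) = A s) \<and>
     (\<forall>x y. x \<noteq> y \<longrightarrow>
        (\<exists>s t. length s = length t \<and> x \<in> A s \<and> y \<in> A t \<and> A s \<noteq> A t))"

definition branch :: "(nat list \<Rightarrow> nat set) \<Rightarrow> nat \<Rightarrow> nat \<Rightarrow> nat" where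
  "branch A x = (THE b. \<forall>n. x \<in> A (map b [0..<n]))"

text \<open>Meaningful only for \<open>x \<noteq> y\<close>.\<close>

definition split_level :: "(nat list \<Rightarrow> nat set) \<Rightarrow> nat \<Rightarrow> nat \<Rightarrow> nat" where
  "split_level A x y = (LEAST n. branch A x n \<noteq> branch A y n)"

text \<open>The colouring of the unordered pair \<open>{x, y}\<close>, as a symmetric function of \<open>x\<close> and \<open>y\<close>.\<close>

definition colour :: "(nat list \<Rightarrow> nat set) \<Rightarrow> nat \<Rightarrow> nat \<Rightarrow> nat \<Rightarrow> nat" where
  "colour A k x y = split_level A x y mod k"

lemma colour_commute: "colour A k x y = colour A k y x"
  by (simp add: colour_def split_level_def eq_commute)

definition homogeneous :: "(nat list \<Rightarrow> nat set) \<Rightarrow> nat \<Rightarrow> nat set \<Rightarrow> bool" where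
  "homogeneous A k H \<longleftrightarrow> (\<exists>i. \<forall>x\<in>H. \<forall>y\<in>H. x \<noteq> y \<longrightarrow> colour A k x y = i)"

text \<open>Properness is not required, so that every family of sets generates an ideal.\<close>

definition set_ideal :: "'a set set \<Rightarrow> bool" where
  "set_ideal I \<longleftrightarrow>
     {} \<in> I \<and>
     (\<forall>X\<in>I. \<forall>Y. Y \<subseteq> X \<longrightarrow> Y \<in> I) \<and>
     (\<forall>X\<in>I. \<forall>Y\<in>I. X \<union> Y \<in> I)"

definition generated_ideal :: "'a set set \<Rightarrow> 'a set set" where
  "generated_ideal S = \<Inter>{I. set_ideal I \<and> S \<subseteq> I}"

definition G_ideal :: "(nat list \<Rightarrow> nat set) \<Rightarrow> nat \<Rightarrow> nat set set" where
  "G_ideal A k = generated_ideal ({H. homogeneous A k H} \<union> {F. finite F})"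

definition T_inf :: "(nat list \<Rightarrow> nat set) \<Rightarrow> nat set \<Rightarrow> nat list set" where
  "T_inf A X = {s. infinite (X \<inter> A s)}"

definition Succs :: "nat list set \<Rightarrow> nat list \<Rightarrow> nat set" where
  "Succs T s = {n. s @ [n] \<in> T}"

definition inf_branching :: "nat list set \<Rightarrow> nat list set" where
  "inf_branching T = {s \<in> T. infinite (Succs T s)}"

definition H_family :: "(nat list \<Rightarrow> nat set) \<Rightarrow> nat \<Rightarrow> nat set set" where
  "H_family A n = {X. [] \<notin> (inf_branching ^^ n) (T_inf A X)}"

end

theory Submission imports Defs begin

text \<open>
  Two observations about split levels carry the proof. If \<open>X\<close> lies outside \<open>H_family A 2\<close>, then
  some cell at level one contains points of \<open>X\<close> splitting at level 1, while \<open>X\<close> also meets other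
  cells at level one, and points in distinct such cells split at level 0; since \<open>0\<close> and \<open>1\<close> are different residues for
  \<open>k \<ge> 2\<close>, such an \<open>X\<close> is not homogeneous (\<open>homogeneous_mem_H_family_2\<close>). Every \<open>H_family A n\<close> is an
  ideal, because unions commute with \<open>T_inf A\<close> and, on the sets of
  nodes that occur, with \<open>inf_branching\<close> (\<open>set_ideal_H_family\<close>). As it contains the
  finite sets, the whole ideal generated by the homogeneous and the finite sets is contained in \<open>H_family A 2\<close>.

  Conversely, nothing prevents a set whose split levels are only \<open>0\<close> and \<open>k\<close>, both congruent to
  \<open>0\<close>, from meeting every cell at level one infinitely often: below each cell at level one, fix a
  node of length \<open>k\<close> and choose one point in each of the cells of its immediate successors. This
  set is homogeneous and lies outside \<open>H_family A 1\<close> (\<open>ex_homogeneous_not_mem_H_family_1\<close>).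
\<close>

section \<open>Branches and split levels\<close>

lemma tree_partition_Union:
  assumes "tree_partition A"
  shows "(\<Union>n. A (s @ [n])) = A s"
  using assms by (simp add: tree_partition_def)

lemma tree_partition_child_subset:
  assumes "tree_partition A"
  shows "A (s @ [n]) \<subseteq> A s"
  using tree_partition_Union[OF assms, of s] by blast

lemma tree_partition_child_unique:
  assumes "tree_partition A" "x \<in> A (s @ [m])" "x \<in> A (s @ [n])"
  shows "m = n"
  using assms unfolding tree_partition_def disjoint_family_on_def by blast

lemma tree_partition_node_unique:
  assumes "tree_partition A" "length s = length t" "x \<in> A s" "x \<in> A t"
  shows "s = t"
  using assms(2-4)
proof (induction s arbitrary: t rule: rev_induct)
  case Nil
  then show ?case by simp
next
  case (snoc m s)
  then obtain u n where t: "t = u @ [n]"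
    by (cases t rule: rev_cases) auto
  have "s = u"
  proof (rule snoc.IH)
    show "length s = length u" using snoc.prems(1) t by simp
    show "x \<in> A s" "x \<in> A u"
      using snoc.prems(2,3) t tree_partition_child_subset[OF assms(1)] by blast+
  qed
  then show ?case
    using snoc.prems t tree_partition_child_unique[OF assms(1)] by blast
qed

lemma ex_branch:
  assumes "tree_partition A"
  shows "\<exists>b. \<forall>n. x \<in> A (map b [0..<n])"
proof -
  have step: "\<exists>m. x \<in> A (s @ [m])" if "x \<in> A s" for s
    using that tree_partition_Union[OF assms, of s] by blast
  define node where "node = rec_nat [] (\<lambda>_ s. s @ [SOME m. x \<in> A (s @ [m])])"
  define b where "b n = (SOME m. x \<in> A (node n @ [m]))" for n
  have node_0: "node 0 = []" and node_Suc: "node (Suc n) = node n @ [b n]" for n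
    by (simp_all add: node_def b_def)
  have "x \<in> A (node n)" for n
  proof (induction n)
    case 0
    then show ?case using assms by (simp add: node_0 tree_partition_def)
  next
    case (Suc n)
    then show ?case unfolding node_Suc b_def by (rule someI_ex[OF step])
  qed
  moreover have "node n = map b [0..<n]" for n
    by (induction n) (simp_all add: node_0 node_Suc)
  ultimately show ?thesis by auto
qed

lemma mem_branch:
  assumes "tree_partition A"
  shows "x \<in> A (map (branch A x) [0..<n])"
proof -
  obtain b where b: "\<forall>n. x \<in> A (map b [0..<n])"
    using ex_branch[OF assms] by blast
  have "c = b" if c: "\<forall>n. x \<in> A (map c [0..<n])" for c
  proof
    fix n
    have "map c [0..<Suc n] = map b [0..<Suc n]"
    proof (rule tree_partition_node_unique[OF assms])
      show "x \<in> A (map c [0..<Suc n])" "x \<in> A (map b [0..<Suc n])"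
        using b c by blast+
    qed simp
    then show "c n = b n" by simp
  qed
  with b have "\<forall>n. x \<in> A (map (branch A x) [0..<n])"
    unfolding branch_def by (rule theI)
  then show ?thesis by blast
qed

lemma branch_nth:
  assumes "tree_partition A" "x \<in> A s" "i < length s"
  shows "branch A x i = s ! i"
proof -
  have "map (branch A x) [0..<length s] = s"
    by (rule tree_partition_node_unique[OF assms(1) _ mem_branch[OF assms(1)] assms(2)]) simp
  then have "s ! i = map (branch A x) [0..<length s] ! i"
    by simp
  with assms(3) show ?thesis by simp
qed

text \<open>
  Both branches start with \<open>s\<close>, and they continue with the distinct values \<open>m\<close> and \<open>n\<close>.
\<close>

lemma split_level_eqI:
  assumes "tree_partition A" "x \<in> A (s @ [m])" "y \<in> A (s @ [n])" "m \<noteq> n"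
  shows "split_level A x y = length s"
  unfolding split_level_def
proof (rule Least_equality)
  show "branch A x (length s) \<noteq> branch A y (length s)"
    using branch_nth[OF assms(1,2), of "length s"] branch_nth[OF assms(1,3), of "length s"]
      assms(4) by simp
next
  fix i
  assume neq: "branch A x i \<noteq> branch A y i"
  show "length s \<le> i"
  proof (rule ccontr)
    assume "\<not> length s \<le> i"
    then show False
      using neq branch_nth[OF assms(1,2), of i] branch_nth[OF assms(1,3), of i]
      by (simp add: nth_append)
  qed
qed

section \<open>The families \<open>H_family A n\<close> are ideals\<close>

text \<open>
  Membership of a node in \<open>inf_branching T\<close> is not decided by its successors alone. The following
  weak form of closure under initial segments makes it so; unlike closure under initial segments
  itself, it is inherited by \<open>inf_branching T\<close>.
\<close>

definition limit_closed :: "nat list set \<Rightarrow> bool" where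
  "limit_closed T \<longleftrightarrow> (\<forall>s. infinite (Succs T s) \<longrightarrow> s \<in> T)"

lemma inf_branching_subset: "inf_branching T \<subseteq> T"
  by (auto simp: inf_branching_def)

lemma Succs_mono: "T \<subseteq> U \<Longrightarrow> Succs T s \<subseteq> Succs U s"
  by (auto simp: Succs_def)

lemma inf_branching_mono: "T \<subseteq> U \<Longrightarrow> inf_branching T \<subseteq> inf_branching U"
  unfolding inf_branching_def using infinite_super[OF Succs_mono[of T U]] by auto

lemma funpow_inf_branching_mono:
  "T \<subseteq> U \<Longrightarrow> (inf_branching ^^ n) T \<subseteq> (inf_branching ^^ n) U"
  by (induction n) (simp_all add: inf_branching_mono)

lemma funpow_inf_branching_subset: "(inf_branching ^^ n) T \<subseteq> T"
  by (induction n) (simp_all add: order_trans[OF inf_branching_subset])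

lemma limit_closed_inf_branching:
  assumes "limit_closed T"
  shows "limit_closed (inf_branching T)"
  unfolding limit_closed_def
proof (intro allI impI)
  fix s
  assume "infinite (Succs (inf_branching T) s)"
  then have "infinite (Succs T s)"
    by (rule infinite_super[OF Succs_mono[OF inf_branching_subset]])
  then show "s \<in> inf_branching T"
    using assms by (simp add: limit_closed_def inf_branching_def)
qed

lemma limit_closed_funpow_inf_branching:
  "limit_closed T \<Longrightarrow> limit_closed ((inf_branching ^^ n) T)"
  by (induction n) (simp_all add: limit_closed_inf_branching)

text \<open>
  If \<open>s\<close> has infinitely many successors in \<open>T \<union> U\<close>, then it has infinitely many in one of the two
  sets, and by \<open>limit_closed\<close> it belongs to that same set.
\<close>

lemma inf_branching_Un:
  assumes "limit_closed T" "limit_closed U"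
  shows "inf_branching (T \<union> U) = inf_branching T \<union> inf_branching U"
proof -
  have "Succs (T \<union> U) s = Succs T s \<union> Succs U s" for s
    by (auto simp: Succs_def)
  then show ?thesis
    using assms by (auto simp: inf_branching_def limit_closed_def)
qed

lemma funpow_inf_branching_Un:
  assumes "limit_closed T" "limit_closed U"
  shows "(inf_branching ^^ n) (T \<union> U) = (inf_branching ^^ n) T \<union> (inf_branching ^^ n) U"
  using assms
  by (induction n) (simp_all add: inf_branching_Un limit_closed_funpow_inf_branching)

lemma T_inf_mono: "X \<subseteq> Y \<Longrightarrow> T_inf A X \<subseteq> T_inf A Y"
  unfolding T_inf_def using finite_subset[OF Int_mono[OF _ order_refl]] by auto

lemma T_inf_Un: "T_inf A (X \<union> Y) = T_inf A X \<union> T_inf A Y"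
  by (auto simp: T_inf_def Int_Un_distrib2)

lemma limit_closed_T_inf:
  assumes "tree_partition A"
  shows "limit_closed (T_inf A X)"
  unfolding limit_closed_def
proof (intro allI impI)
  fix s
  assume "infinite (Succs (T_inf A X) s)"
  then obtain n where "n \<in> Succs (T_inf A X) s"
    using infinite_imp_nonempty by blast
  then have "infinite (X \<inter> A (s @ [n]))"
    by (simp add: Succs_def T_inf_def)
  moreover have "X \<inter> A (s @ [n]) \<subseteq> X \<inter> A s"
    using tree_partition_child_subset[OF assms] by blast
  ultimately show "s \<in> T_inf A X"
    unfolding T_inf_def by (blast dest: infinite_super)
qed

lemma finite_mem_H_family:
  assumes "finite X"
  shows "X \<in> H_family A n"
proof -
  have "T_inf A X = {}"
    using assms by (simp add: T_inf_def)
  then show ?thesis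
    using funpow_inf_branching_subset[of n "T_inf A X"] by (auto simp: H_family_def)
qed

lemma set_ideal_H_family:
  assumes "tree_partition A"
  shows "set_ideal (H_family A n)"
  unfolding set_ideal_def
proof (intro conjI ballI allI impI)
  show "{} \<in> H_family A n"
    by (rule finite_mem_H_family) simp
next
  fix X Y
  assume "X \<in> H_family A n" "Y \<subseteq> X"
  then show "Y \<in> H_family A n"
    using funpow_inf_branching_mono[OF T_inf_mono[of Y X A], of n]
    by (auto simp: H_family_def)
next
  fix X Y
  assume "X \<in> H_family A n" "Y \<in> H_family A n"
  then show "X \<union> Y \<in> H_family A n"
    by (simp add: H_family_def T_inf_Un funpow_inf_branching_Un limit_closed_T_inf[OF assms])
qed

lemma generated_ideal_subset:
  assumes "set_ideal I" "S \<subseteq> I"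
  shows "generated_ideal S \<subseteq> I"
  using assms by (auto simp: generated_ideal_def)

lemma subset_generated_ideal: "S \<subseteq> generated_ideal S"
  by (auto simp: generated_ideal_def)

section \<open>Homogeneous sets\<close>

text \<open>
  Infinitely many children of the root having infinitely many children in \<open>T_inf A X\<close> yields three points of \<open>X\<close>: two in a common cell at level
  one, splitting at level 1, and a third in another cell, splitting from them at level 0.
\<close>

lemma homogeneous_mem_H_family_2:
  assumes "tree_partition A" "2 \<le> k" "homogeneous A k X"
  shows "X \<in> H_family A 2"
proof (rule ccontr)
  let ?T = "T_inf A X"
  assume "X \<notin> H_family A 2"
  then have inf: "infinite (Succs (inf_branching ?T) [])"
    by (simp add: H_family_def inf_branching_def numeral_2_eq_2)
  have two: "\<exists>m n. m \<in> S \<and> n \<in> S \<and> m \<noteq> n" if "infinite S" for S :: "nat set"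
  proof -
    obtain m where "m \<in> S" using infinite_imp_nonempty[OF \<open>infinite S\<close>] by blast
    moreover have "infinite (S - {m})" using that by simp
    then obtain n where "n \<in> S - {m}" using infinite_imp_nonempty by blast
    ultimately show ?thesis by blast
  qed
  have pt: "\<exists>x. x \<in> X \<and> x \<in> A s" if "s \<in> ?T" for s
  proof -
    have "X \<inter> A s \<noteq> {}" using that by (auto simp: T_inf_def)
    then show ?thesis by blast
  qed
  obtain p q where pq: "[p] \<in> inf_branching ?T" "[q] \<in> inf_branching ?T" "p \<noteq> q"
    using two[OF inf] by (auto simp: Succs_def)
  then have "infinite (Succs ?T [p])"
    by (simp add: inf_branching_def)
  from two[OF this] obtain m n where mn: "[p, m] \<in> ?T" "[p, n] \<in> ?T" "m \<noteq> n"
    by (auto simp: Succs_def)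
  obtain x y z where x: "x \<in> X" "x \<in> A [p, m]" and y: "y \<in> X" "y \<in> A [p, n]"
    and z: "z \<in> X" "z \<in> A [q]"
    using pt[OF mn(1)] pt[OF mn(2)] pt[OF subsetD[OF inf_branching_subset pq(2)]] by blast
  have "x \<in> A [p]"
    using x(2) tree_partition_child_subset[OF assms(1), of "[p]" m] by auto
  then have "split_level A x z = 0" "x \<noteq> z"
    using split_level_eqI[OF assms(1), of x "[]" p z q]
      tree_partition_child_unique[OF assms(1), of x "[]" p q] z(2) pq(3) by auto
  moreover have "split_level A x y = 1" "x \<noteq> y"
    using split_level_eqI[OF assms(1), of x "[p]" m y n]
      tree_partition_child_unique[OF assms(1), of x "[p]" m n] x(2) y(2) mn(3) by auto
  ultimately have "colour A k x z = 0" "colour A k x y = 1"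
    using assms(2) by (simp_all add: colour_def)
  moreover have "colour A k x z = colour A k x y"
    using assms(3) x(1) y(1) z(1) \<open>x \<noteq> z\<close> \<open>x \<noteq> y\<close> unfolding homogeneous_def by blast
  ultimately show False by simp
qed

text \<open>
  The node \<open>n # replicate (k - 1) 0\<close> has length \<open>k\<close>, so points chosen from distinct immediate
  successor cells of it split at level \<open>k\<close>. The zeros are arbitrary: any node of length \<open>k\<close>
  extending \<open>[n]\<close> would do.
\<close>

lemma ex_homogeneous_not_mem_H_family_1:
  assumes "tree_partition A" "0 < k"
  shows "\<exists>X. homogeneous A k X \<and> X \<notin> H_family A 1"
proof -
  define node where "node n = n # replicate (k - 1) (0::nat)" for n :: nat
  have len: "length (node n) = k" for n
    using assms(2) by (simp add: node_def)
  have "infinite (A s)" for s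
    using assms(1) unfolding tree_partition_def by (elim conjE) (erule spec)
  then have "A s \<noteq> {}" for s
    by (rule infinite_imp_nonempty)
  then have pick: "(SOME x. x \<in> A s) \<in> A s" for s
    by (simp add: some_in_eq)
  define f where "f n m = (SOME x. x \<in> A (node n @ [m]))" for n m
  define X where "X = {f n m | n m. True}"
  have f_mem: "f n m \<in> A (node n @ [m])" for n m
    by (simp add: f_def pick)
  have append_subset: "A (s @ t) \<subseteq> A s" for s t
  proof (induction t rule: rev_induct)
    case (snoc a t)
    then show ?case
      using tree_partition_child_subset[OF assms(1), of "s @ t" a] by auto
  qed simp
  have f_mem_root: "f n m \<in> A ([] @ [n])" for n m
    using f_mem[of n m] append_subset[of "[n]" "replicate (k - 1) 0 @ [m]"]
    by (auto simp: node_def)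
  have "colour A k (f n m) (f n' m') = 0" if "f n m \<noteq> f n' m'" for n m n' m'
  proof (cases "n = n'")
    case True
    with that have "m \<noteq> m'" by auto
    with True have "split_level A (f n m) (f n' m') = k"
      using split_level_eqI[OF assms(1) f_mem[of n m] f_mem[of n m']] len by simp
    then show ?thesis by (simp add: colour_def)
  next
    case False
    then show ?thesis
      using split_level_eqI[OF assms(1) f_mem_root f_mem_root, of n n' m m']
      by (simp add: colour_def)
  qed
  then have "homogeneous A k X"
    by (auto simp: homogeneous_def X_def)
  moreover have "X \<notin> H_family A 1"
  proof -
    have "[n] \<in> T_inf A X" for n
    proof -
      have "inj (f n)"
      proof (rule injI)
        fix m m'
        assume "f n m = f n m'"
        then show "m = m'"
          using tree_partition_child_unique[OF assms(1) f_mem[of n m]] f_mem[of n m'] by simp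
      qed
      then have "infinite (range (f n))"
        by (simp add: finite_image_iff)
      moreover have "range (f n) \<subseteq> X \<inter> A [n]"
        using f_mem_root by (auto simp: X_def)
      ultimately show ?thesis
        unfolding T_inf_def by (blast dest: infinite_super)
    qed
    then have "infinite (Succs (T_inf A X) [])"
      by (simp add: Succs_def)
    then show ?thesis
      using limit_closed_T_inf[OF assms(1)]
      by (simp add: H_family_def inf_branching_def limit_closed_def)
  qed
  ultimately show ?thesis by blast
qed

theorem theorem5p2:
  fixes A :: "nat list \<Rightarrow> nat set"
  assumes "tree_partition A"
  shows "\<forall>k\<ge>2. G_ideal A k \<subseteq> H_family A 2 \<and> \<not> G_ideal A k \<subseteq> H_family A 1"
proof (intro allI impI conjI)
  fix k :: nat
  assume k: "2 \<le> k"
  show "G_ideal A k \<subseteq> H_family A 2"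
    unfolding G_ideal_def
    using homogeneous_mem_H_family_2[OF assms k] finite_mem_H_family
    by (intro generated_ideal_subset set_ideal_H_family[OF assms]) auto
  obtain X where "homogeneous A k X" "X \<notin> H_family A 1"
    using ex_homogeneous_not_mem_H_family_1[OF assms, of k] k by auto
  then show "\<not> G_ideal A k \<subseteq> H_family A 1"
    using subsetD[OF subset_generated_ideal, of X "{H. homogeneous A k H} \<union> {F. finite F}"]
    by (auto simp: G_ideal_def)
qed

end
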